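(* Let $n\ge2$, let $(V_1,\ldots,V_n)$ be an $n$-isometry on a Hilbert space $\mathcal{H}$, let $V=\prod_{i=1}^nV_i$, $\mathcal{W}=\ker V^*$, $\tilde V_i=\prod_{j\neq i}V_j$, $\tilde{\mathcal{W}}_i=\ker\tilde V_i^*\subseteq\mathcal{W}$, and let $U_i=(P_{\mathcal{W}}V_i+\tilde V_i^* )|_{\mathcal{W}}$, $i=1,\ldots,n$, which are unitary operators on $\mathcal{W}$. Then: (a) $U_pU_q=U_qU_p$ for $p,q=1,\ldots,n$; (b) $\prod_{p=1}^nU_p=I_{\mathcal{W}}$; (c) $P_{\tilde{\mathcal{W}}_i}^\perp+U_i^*P_{\tilde{\mathcal{W}}_j}^\perp U_i=P_{\tilde{\mathcal{W}}_j}^\perp+U_j^*P_{\tilde{\mathcal{W}}_i}^\perp U_j\le I_{\mathcal{W}}$ for $1\le i<j\le n$; (d) $P_{\tilde{\mathcal{W}}_1}^\perp+U_1^*P_{\tilde{\mathcal{W}}_2}^\perp U_1+U_1^*U_2^*P_{\tilde{\mathcal{W}}_3}^\perp U_2U_1+\cdots+\Big(\prod_{i=1}^{n-1}U_i^*\Big)P_{\tilde{\mathcal{W}}_n}^\perp\Big(\prod_{i=1}^{n-1}U_i\Big)=I_{\mathcal{W}}$.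
   Context: An isometry $X$ is a shift if $X^{*m}\to0$ strongly as $m\to\infty$. An $n$-isometry on $\mathcal{H}$ ($n\ge 2$) is an $n$-tuple $(V_1,\ldots,V_n)$ of commuting isometries on $\mathcal{H}$ such that $V=V_1\cdots V_n$ is a shift. $P_{\mathcal{W}}$ is the orthogonal projection of $\mathcal{H}$ onto $\mathcal{W}$; $P_{\tilde{\mathcal{W}}_i}\in\mathcal{B}(\mathcal{W})$ is the orthogonal projection of $\mathcal{W}$ onto $\tilde{\mathcal{W}}_i$ and $P_{\tilde{\mathcal{W}}_i}^\perp=I_{\mathcal{W}}-P_{\tilde{\mathcal{W}}_i}$. *)

theory Defs
  imports "HOL-Analysis.Analysis" "HOL-Library.Nonpos_Ints"
begin

text \<open>Complex Hilbert spaces; the inner product is linear in its first argument. Completeness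
  comes from \<^class>\<open>banach\<close>, definiteness from \<open>cinner_self\<close>.\<close>

class complex_hilbert = banach +
  fixes scaleC :: "complex \<Rightarrow> 'a \<Rightarrow> 'a"
    and cinner :: "'a \<Rightarrow> 'a \<Rightarrow> complex"
  assumes scaleC_add_right: "scaleC c (x + y) = scaleC c x + scaleC c y"
    and scaleC_add_left: "scaleC (c + d) x = scaleC c x + scaleC d x"
    and scaleC_scaleC: "scaleC c (scaleC d x) = scaleC (c * d) x"
    and scaleC_of_real: "scaleC (complex_of_real r) x = scaleR r x"
    and cinner_commute: "cinner x y = cnj (cinner y x)"
    and cinner_add_left: "cinner (x + y) z = cinner x z + cinner y z"
    and cinner_scaleC_left: "cinner (scaleC c x) y = c * cinner x y"
    and cinner_self: "cinner x x = complex_of_real ((norm x)\<^sup>2)"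

instantiation complex :: complex_hilbert
begin

definition scaleC_complex :: "complex \<Rightarrow> complex \<Rightarrow> complex"
  where "scaleC_complex c x = c * x"

definition cinner_complex :: "complex \<Rightarrow> complex \<Rightarrow> complex"
  where "cinner_complex x y = x * cnj y"

instance
  by standard
    (auto simp: scaleC_complex_def cinner_complex_def algebra_simps scaleR_conv_of_real
      complex_norm_square[symmetric])

end

text \<open>An operator on a closed subspace \<open>M\<close> is represented by a function on the whole type of which
  only the values on \<open>M\<close> matter; operators on \<open>M\<close> are therefore compared pointwise on \<open>M\<close>.\<close>

definition bounded_op_on :: "'a::complex_hilbert set \<Rightarrow> ('a \<Rightarrow> 'a) \<Rightarrow> bool"
  where "bounded_op_on M T \<longleftrightarrow>
    (\<forall>x\<in>M. T x \<in> M) \<and>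
    (\<forall>x\<in>M. \<forall>y\<in>M. T (x + y) = T x + T y) \<and>
    (\<forall>c. \<forall>x\<in>M. T (scaleC c x) = scaleC c (T x)) \<and>
    (\<exists>K. \<forall>x\<in>M. norm (T x) \<le> K * norm x)"

text \<open>The adjoint of \<open>T\<close> as an operator on the Hilbert space \<open>M\<close>.\<close>

definition adj_on :: "'a::complex_hilbert set \<Rightarrow> ('a \<Rightarrow> 'a) \<Rightarrow> 'a \<Rightarrow> 'a"
  where "adj_on M T y = (THE z. z \<in> M \<and> (\<forall>x\<in>M. cinner (T x) y = cinner x z))"

abbreviation adj :: "('a::complex_hilbert \<Rightarrow> 'a) \<Rightarrow> 'a \<Rightarrow> 'a"
  where "adj \<equiv> adj_on UNIV"

definition unitary_on :: "'a::complex_hilbert set \<Rightarrow> ('a \<Rightarrow> 'a) \<Rightarrow> bool"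
  where "unitary_on M T \<longleftrightarrow> bounded_op_on M T \<and>
    (\<forall>x\<in>M. adj_on M T (T x) = x) \<and> (\<forall>x\<in>M. T (adj_on M T x) = x)"

definition op_le_on :: "'a::complex_hilbert set \<Rightarrow> ('a \<Rightarrow> 'a) \<Rightarrow> ('a \<Rightarrow> 'a) \<Rightarrow> bool"
  where "op_le_on M S T \<longleftrightarrow> (\<forall>x\<in>M. cinner (T x - S x) x \<in> \<real>\<^sub>\<ge>\<^sub>0)"

definition orth_proj :: "'a::complex_hilbert set \<Rightarrow> 'a \<Rightarrow> 'a"
  where "orth_proj M x = (THE y. y \<in> M \<and> (\<forall>z\<in>M. cinner (x - y) z = 0))"

definition orth_proj_perp :: "'a::complex_hilbert set \<Rightarrow> 'a \<Rightarrow> 'a"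
  where "orth_proj_perp M x = x - orth_proj M x"

definition op_ker :: "('a::complex_hilbert \<Rightarrow> 'a) \<Rightarrow> 'a set"
  where "op_ker T = {x. T x = 0}"

definition isometry_op :: "('a::complex_hilbert \<Rightarrow> 'a) \<Rightarrow> bool"
  where "isometry_op T \<longleftrightarrow> bounded_op_on UNIV T \<and> (\<forall>x. norm (T x) = norm x)"

definition shift_op :: "('a::complex_hilbert \<Rightarrow> 'a) \<Rightarrow> bool"
  where "shift_op T \<longleftrightarrow> isometry_op T \<and> (\<forall>x. (\<lambda>m. (adj T ^^ m) x) \<longlonglongrightarrow> 0)"

text \<open>\<open>op_prod T [i\<^sub>1, \<dots>, i\<^sub>k] = T i\<^sub>1 \<circ> \<dots> \<circ> T i\<^sub>k\<close>\<close>

definition op_prod :: "(nat \<Rightarrow> 'a \<Rightarrow> 'a) \<Rightarrow> nat list \<Rightarrow> 'a \<Rightarrow> 'a"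
  where "op_prod T is = foldr (\<lambda>i S. T i \<circ> S) is id"

text \<open>Only the components \<open>V 1, \<dots>, V n\<close> of \<open>V\<close> are relevant.\<close>

definition V_prod :: "nat \<Rightarrow> (nat \<Rightarrow> 'a \<Rightarrow> 'a) \<Rightarrow> 'a \<Rightarrow> 'a"
  where "V_prod n V = op_prod V [1..<Suc n]"

definition n_isometry :: "nat \<Rightarrow> (nat \<Rightarrow> 'a::complex_hilbert \<Rightarrow> 'a) \<Rightarrow> bool"
  where "n_isometry n V \<longleftrightarrow> 2 \<le> n \<and>
    (\<forall>i\<in>{1..n}. isometry_op (V i)) \<and>
    (\<forall>i\<in>{1..n}. \<forall>j\<in>{1..n}. V i \<circ> V j = V j \<circ> V i) \<and>
    shift_op (V_prod n V)"

definition V_tilde :: "nat \<Rightarrow> (nat \<Rightarrow> 'a \<Rightarrow> 'a) \<Rightarrow> nat \<Rightarrow> 'a \<Rightarrow> 'a"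
  where "V_tilde n V i = op_prod V (filter (\<lambda>j. j \<noteq> i) [1..<Suc n])"

definition W_space :: "nat \<Rightarrow> (nat \<Rightarrow> 'a::complex_hilbert \<Rightarrow> 'a) \<Rightarrow> 'a set"
  where "W_space n V = op_ker (adj (V_prod n V))"

definition W_tilde :: "nat \<Rightarrow> (nat \<Rightarrow> 'a::complex_hilbert \<Rightarrow> 'a) \<Rightarrow> nat \<Rightarrow> 'a set"
  where "W_tilde n V i = op_ker (adj (V_tilde n V i))"

definition U_op :: "nat \<Rightarrow> (nat \<Rightarrow> 'a::complex_hilbert \<Rightarrow> 'a) \<Rightarrow> nat \<Rightarrow> 'a \<Rightarrow> 'a"
  where "U_op n V i w = orth_proj (W_space n V) (V i w) + adj (V_tilde n V i) w"

end

theory Submission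
  imports Defs
begin

text \<open>Adjoints of isometries exist by projecting onto their closed ranges. With
  \<open>A = V\<^sub>i\<close> and \<open>B = \<Prod>k\<noteq>i. V\<^sub>k\<close> one finds \<open>U\<^sub>i = A (I - B B\<^sup>*) + B\<^sup>*\<close> on \<open>W\<close>, with inverse
  \<open>A\<^sup>* + B (I - A A\<^sup>*)\<close>. Mapping a finite sum \<open>\<Sum>k. V\<^sup>k w\<^sub>k\<close> with \<open>w\<^sub>k \<in> W\<close> to \<open>\<Sum>k. w\<^sub>k\<close> is well defined,
  intertwines every \<open>V\<^sub>i\<close> with \<open>U\<^sub>i\<close>, and sends \<open>V w\<close> to \<open>w\<close>; this gives (a) and (b). If
  \<open>B = Q R\<close>, then \<open>U\<^sub>i\<^sup>* (A Q) (A Q)\<^sup>* U\<^sub>i = Q Q\<^sup>* - B B\<^sup>*\<close> on \<open>W\<close>. For \<open>Q = \<Prod>k\<noteq>i,j. V\<^sub>k\<close> this shows that both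
  sides of (c) are the projection \<open>Q Q\<^sup>*\<close>, and for \<open>Q = V\<^sub>1 \<cdots> V\<^sub>i\<^sub>-\<^sub>1\<close> it makes the sum in (d) telescope.\<close>

section \<open>Inner product and norm identities\<close>

lemma cinner_add_right: "cinner x (y + z) = cinner x y + cinner x (z::'a::complex_hilbert)"
  by (metis cinner_add_left cinner_commute complex_cnj_add)

lemma cinner_scaleC_right: "cinner x (scaleC c y) = cnj c * cinner x (y::'a::complex_hilbert)"
  by (metis cinner_scaleC_left cinner_commute complex_cnj_mult)

lemma cinner_zero_left [simp]: "cinner 0 (x::'a::complex_hilbert) = 0"
  using cinner_add_left[of 0 0 x] by simp

lemma cinner_zero_right [simp]: "cinner (x::'a::complex_hilbert) 0 = 0"
  using cinner_add_right[of x 0 0] by simp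

lemma cinner_diff_left: "cinner (x - y) z = cinner x z - cinner y (z::'a::complex_hilbert)"
  using cinner_add_left[of "x - y" y z] by simp

lemma cinner_diff_right: "cinner x (y - z) = cinner x y - cinner x (z::'a::complex_hilbert)"
  using cinner_add_right[of x "y - z" z] by simp

lemma scaleC_zero_right [simp]: "scaleC c (0::'a::complex_hilbert) = 0"
  using scaleC_add_right[of c 0 "0::'a"] by simp

lemma scaleC_diff_right: "scaleC c (x - y) = scaleC c x - scaleC c (y::'a::complex_hilbert)"
  using scaleC_add_right[of c "x - y" y] by simp

lemma norm_eq_cinner: "(norm x)\<^sup>2 = Re (cinner x (x::'a::complex_hilbert))"
  by (simp add: cinner_self)

lemma cinner_self_eq_0_iff: "cinner x x = 0 \<longleftrightarrow> x = (0::'a::complex_hilbert)"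
  by (simp add: cinner_self)

lemma cinner_left_cancel:
  assumes "\<And>x. cinner x y = cinner x (z::'a::complex_hilbert)"
  shows "y = z"
  using assms[of "y - z"] cinner_self_eq_0_iff[of "y - z"] by (simp add: cinner_diff_right)

text \<open>Serves to compare a nearest point \<open>y\<close> with its perturbations
  \<open>y + scaleC c z\<close>.\<close>

lemma norm_diff_scaleC:
  "(norm (u - scaleC c z))\<^sup>2
    = (norm u)\<^sup>2 - 2 * Re (cnj c * cinner u z) + (cmod c)\<^sup>2 * (norm (z::'a::complex_hilbert))\<^sup>2"
proof -
  have zu: "cinner z u = cnj (cinner u z)"
    by (rule cinner_commute)
  have "cinner (u - scaleC c z) (u - scaleC c z)
    = cinner u u - cnj c * cinner u z - c * cinner z u + (c * cnj c) * cinner z z"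
    by (simp add: cinner_diff_left cinner_diff_right cinner_scaleC_left cinner_scaleC_right
        algebra_simps)
  also have "\<dots> = cinner u u - cnj c * cinner u z - cnj (cnj c * cinner u z)
      + complex_of_real ((cmod c)\<^sup>2) * complex_of_real ((norm z)\<^sup>2)"
    by (simp only: zu complex_norm_square cinner_self complex_cnj_mult complex_cnj_cnj)
  finally show ?thesis
    by (simp only: norm_eq_cinner[of "u - scaleC c z"] norm_eq_cinner[of u]) simp
qed

lemma norm_add_square:
  "(norm (x + y))\<^sup>2 = (norm x)\<^sup>2 + (norm y)\<^sup>2 + 2 * Re (cinner x (y::'a::complex_hilbert))"
proof -
  have "Re (cinner y x) = Re (cinner x y)"
    by (metis cinner_commute cnj.sel(1))
  then show ?thesis
    by (simp add: norm_eq_cinner cinner_add_left cinner_add_right)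
qed

lemma parallelogram_law_cinner:
  "(norm (x + y))\<^sup>2 + (norm (x - y))\<^sup>2 = 2 * (norm x)\<^sup>2 + 2 * (norm (y::'a::complex_hilbert))\<^sup>2"
  by (simp add: norm_eq_cinner cinner_add_left cinner_add_right cinner_diff_left cinner_diff_right)

section \<open>Nearest points in subspaces; uniqueness of projections and adjoints\<close>

definition csubspace :: "'a::complex_hilbert set \<Rightarrow> bool"
  where "csubspace M \<longleftrightarrow> 0 \<in> M \<and> (\<forall>x\<in>M. \<forall>y\<in>M. x + y \<in> M) \<and> (\<forall>c. \<forall>x\<in>M. scaleC c x \<in> M)"

lemma csubspace_diff:
  assumes "csubspace M" "x \<in> M" "y \<in> M"
  shows "x - y \<in> (M::'a::complex_hilbert set)"
proof -
  have "scaleC (complex_of_real (-1)) y \<in> M"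
    using assms unfolding csubspace_def by blast
  then have "x + scaleC (complex_of_real (-1)) y \<in> M"
    using assms unfolding csubspace_def by blast
  then show ?thesis
    by (simp only: scaleC_of_real) simp
qed

text \<open>A minimizing sequence is Cauchy by the parallelogram law; completeness and closedness of
  \<open>M\<close> supply the limit.\<close>

lemma ex_nearest_point:
  fixes M :: "'a::complex_hilbert set"
  assumes M: "csubspace M" "closed M"
  shows "\<exists>y\<in>M. \<forall>z\<in>M. norm (x - y) \<le> norm (x - z)"
proof -
  define d where "d = Inf ((\<lambda>z. (norm (x - z))\<^sup>2) ` M)"
  have ne: "M \<noteq> {}"
    using M unfolding csubspace_def by auto
  have bdd: "bdd_below ((\<lambda>z. (norm (x - z))\<^sup>2) ` M)"
    by (rule bdd_belowI[of _ 0]) auto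
  have d_le: "d \<le> (norm (x - z))\<^sup>2" if "z \<in> M" for z
    unfolding d_def by (rule cInf_lower[OF _ bdd]) (use that in auto)
  have "\<exists>z\<in>M. (norm (x - z))\<^sup>2 < d + inverse (real (Suc k))" for k
    using cInf_lessD[of "(\<lambda>z. (norm (x - z))\<^sup>2) ` M" "d + inverse (real (Suc k))"] ne
    unfolding d_def by auto
  then obtain z where zM: "\<And>k. z k \<in> M"
    and z: "\<And>k. (norm (x - z k))\<^sup>2 < d + inverse (real (Suc k))"
    by metis
  have near: "(norm (z k - z l))\<^sup>2 \<le> 2 * inverse (real (Suc k)) + 2 * inverse (real (Suc l))" for k l
  proof -
    \<comment> \<open>The midpoint stays in \<open>M\<close>, so its squared distance to
      \<open>x\<close> is at least \<open>d\<close>; this bounds one side of the parallelogram law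
      from below.\<close>
    let ?m = "scaleC (complex_of_real (1/2)) (z k + z l)"
    have "?m \<in> M"
      using M zM unfolding csubspace_def by blast
    then have "d \<le> (norm (x - ?m))\<^sup>2"
      by (rule d_le)
    moreover have "(x - z k) + (x - z l) = 2 *\<^sub>R (x - ?m)"
      by (simp only: scaleC_of_real) (simp add: scaleR_right_diff_distrib scaleR_2)
    then have "(norm ((x - z k) + (x - z l)))\<^sup>2 = 4 * (norm (x - ?m))\<^sup>2"
      by (simp add: power_mult_distrib)
    moreover have "(norm ((x - z k) - (x - z l)))\<^sup>2 = (norm (z k - z l))\<^sup>2"
      by (simp add: norm_minus_commute)
    ultimately show ?thesis
      using parallelogram_law_cinner[of "x - z k" "x - z l"] z[of k] z[of l] by linarith
  qed
  have "Cauchy z"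
  proof (rule CauchyI)
    fix e :: real
    assume e: "e > 0"
    then obtain N where N: "inverse (real (Suc N)) < e\<^sup>2 / 4"
      using reals_Archimedean[of "e\<^sup>2 / 4"] by auto
    show "\<exists>N. \<forall>k\<ge>N. \<forall>l\<ge>N. norm (z k - z l) < e"
    proof (intro exI allI impI)
      fix k l
      assume "N \<le> k" "N \<le> l"
      then have "inverse (real (Suc k)) \<le> inverse (real (Suc N))"
        "inverse (real (Suc l)) \<le> inverse (real (Suc N))"
        by (auto intro!: le_imp_inverse_le)
      with near[of k l] N have "(norm (z k - z l))\<^sup>2 < e\<^sup>2"
        by linarith
      then show "norm (z k - z l) < e"
        using e by (simp add: power_less_imp_less_base)
    qed
  qed
  then obtain y where y: "z \<longlonglongrightarrow> y"
    using Cauchy_convergent[of z] unfolding convergent_def by blast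
  have "y \<in> M"
    using \<open>closed M\<close> zM y closed_sequentially by blast
  moreover have "(norm (x - y))\<^sup>2 \<le> d"
  proof (rule LIMSEQ_le)
    show "(\<lambda>k. (norm (x - z k))\<^sup>2) \<longlonglongrightarrow> (norm (x - y))\<^sup>2"
      by (intro tendsto_intros y)
    show "(\<lambda>k. d + inverse (real (Suc k))) \<longlonglongrightarrow> d"
      using tendsto_add[OF tendsto_const[of d] LIMSEQ_inverse_real_of_nat] by simp
    show "\<exists>N. \<forall>k\<ge>N. (norm (x - z k))\<^sup>2 \<le> d + inverse (real (Suc k))"
      using z less_imp_le by blast
  qed
  ultimately show ?thesis
    using d_le by (meson norm_ge_zero order_trans power2_le_imp_le)
qed

text \<open>Otherwise moving \<open>y\<close> by the component of \<open>x - y\<close> along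
  \<open>z\<close> would come closer to \<open>x\<close>: for this \<open>c\<close> the squared norm
  drops by |c|^2 |z|^2.\<close>

lemma nearest_point_orthogonal:
  fixes M :: "'a::complex_hilbert set"
  assumes M: "csubspace M" and "y \<in> M" "z \<in> M" and min: "\<forall>z\<in>M. norm (x - y) \<le> norm (x - z)"
  shows "cinner (x - y) z = 0"
proof (cases "z = 0")
  case False
  define c where "c = cinner (x - y) z / complex_of_real ((norm z)\<^sup>2)"
  have "y + scaleC c z \<in> M"
    using assms unfolding csubspace_def by blast
  with min have "norm (x - y) \<le> norm ((x - y) - scaleC c z)"
    by (metis diff_diff_add)
  then have "(norm (x - y))\<^sup>2 \<le> (norm ((x - y) - scaleC c z))\<^sup>2"
    by (simp add: power_mono)
  moreover have "cinner (x - y) z = c * complex_of_real ((norm z)\<^sup>2)"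
    using False by (simp add: c_def)
  then have "cnj c * cinner (x - y) z = complex_of_real ((cmod c)\<^sup>2 * (norm z)\<^sup>2)"
    by (metis complex_norm_square mult.assoc mult.commute of_real_mult)
  then have "Re (cnj c * cinner (x - y) z) = (cmod c)\<^sup>2 * (norm z)\<^sup>2"
    by simp
  ultimately have "(cmod c)\<^sup>2 * (norm z)\<^sup>2 \<le> 0"
    unfolding norm_diff_scaleC by linarith
  then have "c = 0"
    using False by (simp add: mult_le_0_iff)
  then show ?thesis
    using False by (simp add: c_def)
qed simp

text \<open>Two candidates differ by a vector of \<open>M\<close> that is orthogonal to itself. This
  turns the definite description into an explicit value.\<close>

lemma orth_proj_unique:
  fixes M :: "'a::complex_hilbert set"
  assumes M: "csubspace M" and "y \<in> M" "\<And>z. z \<in> M \<Longrightarrow> cinner (x - y) z = 0"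
  shows "orth_proj M x = y"
  unfolding orth_proj_def
proof (rule the_equality)
  fix y'
  assume y': "y' \<in> M \<and> (\<forall>z\<in>M. cinner (x - y') z = 0)"
  then have "y' - y \<in> M"
    using assms csubspace_diff by blast
  with assms y' have "cinner (x - y) (y' - y) - cinner (x - y') (y' - y) = 0"
    by simp
  then have "cinner (y' - y) (y' - y) = 0"
    by (simp flip: cinner_diff_left)
  then show "y' = y"
    by (simp add: cinner_self_eq_0_iff)
qed (use assms in auto)

lemma adj_on_unique:
  fixes M :: "'a::complex_hilbert set"
  assumes M: "csubspace M" and "z \<in> M" "\<And>x. x \<in> M \<Longrightarrow> cinner (T x) y = cinner x z"
  shows "adj_on M T y = z"
  unfolding adj_on_def
proof (rule the_equality)
  fix z'
  assume z': "z' \<in> M \<and> (\<forall>x\<in>M. cinner (T x) y = cinner x z')"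
  then have "z' - z \<in> M"
    using assms csubspace_diff by blast
  with assms z' have "cinner (z' - z) z' = cinner (z' - z) z"
    by metis
  then show "z' = z"
    using cinner_self_eq_0_iff[of "z' - z"] by (simp add: cinner_diff_right)
qed (use assms in auto)

lemma csubspace_UNIV: "csubspace UNIV"
  by (simp add: csubspace_def)

lemma isometry_opD:
  assumes "isometry_op T"
  shows isometry_add: "T (x + y) = T x + T y"
    and isometry_scaleC: "T (scaleC c x) = scaleC c (T x)"
    and isometry_norm: "norm (T x) = norm x"
  using assms by (auto simp: isometry_op_def bounded_op_on_def)

lemma isometry_diff: "isometry_op T \<Longrightarrow> T (x - y) = T x - T y"
  using isometry_add[of T "x - y" y] by simp

lemma isometry_zero: "isometry_op T \<Longrightarrow> T 0 = 0"
  using isometry_diff[of T 0 0] by simp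

lemma isometry_comp: "isometry_op S \<Longrightarrow> isometry_op T \<Longrightarrow> isometry_op (S \<circ> T)"
  by (auto simp: isometry_op_def bounded_op_on_def intro: exI[of _ 1])

lemma isometry_id: "isometry_op id"
  by (auto simp: isometry_op_def bounded_op_on_def intro: exI[of _ 1])

text \<open>Polarization: expanding the norm of a sum gives the real parts, and replacing
  \<open>y\<close> by \<open>scaleC \<i> y\<close> gives the imaginary parts.\<close>

lemma isometry_cinner:
  assumes "isometry_op T"
  shows "cinner (T x) (T y) = cinner x y"
proof -
  have re: "Re (cinner (T x) (T y)) = Re (cinner x y)" for x y
    using norm_add_square[of "T x" "T y"] norm_add_square[of x y] isometry_opD[OF assms]
    by (metis add_left_cancel mult_cancel_left zero_neq_numeral)
  have "Re (cinner (T x) (T (scaleC \<i> y))) = Re (cinner x (scaleC \<i> y))"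
    by (rule re)
  then have "Im (cinner (T x) (T y)) = Im (cinner x y)"
    by (simp add: isometry_scaleC[OF assms] cinner_scaleC_right)
  with re show ?thesis
    by (simp add: complex_eq_iff)
qed

section \<open>Adjoints of isometries\<close>

lemma closed_range_isometry:
  assumes "isometry_op (T :: 'a::complex_hilbert \<Rightarrow> 'a)"
  shows "closed (range T)"
proof -
  have "T (scaleR r x) = scaleR r (T x)" for r x
    using isometry_scaleC[OF assms, of "complex_of_real r" x] by (simp add: scaleC_of_real)
  then have "bounded_linear T"
    by (intro bounded_linear_intro[of _ 1]) (simp_all add: isometry_add[OF assms] isometry_norm[OF assms])
  then have "complete (range T)"
    by (intro complete_isometric_image[of 1]) (simp_all add: isometry_norm[OF assms] complete_UNIV)
  then show ?thesis
    by (rule complete_imp_closed)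
qed

text \<open>The point of the closed range of \<open>T\<close> nearest to \<open>y\<close> is some
  \<open>T z\<close>, and this \<open>z\<close> serves as \<open>adj T y\<close>.\<close>

lemma cinner_adj:
  assumes T: "isometry_op (T :: 'a::complex_hilbert \<Rightarrow> 'a)"
  shows "cinner (T x) y = cinner x (adj T y)"
proof -
  have M: "csubspace (range T)"
    unfolding csubspace_def
    by (auto simp flip: isometry_add[OF T] isometry_scaleC[OF T])
      (metis T isometry_zero rangeI)
  obtain z where z: "\<And>x. cinner (y - T z) (T x) = 0"
    using ex_nearest_point[OF M closed_range_isometry[OF T], of y] nearest_point_orthogonal[OF M]
    by (metis (no_types, lifting) imageE rangeI)
  have eq: "cinner (T x) y = cinner x z" for x
  proof -
    have "cinner y (T x) = cinner z x"
      using z[of x] by (simp add: cinner_diff_left isometry_cinner[OF T])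
    then show ?thesis
      by (metis cinner_commute)
  qed
  then show ?thesis
    using adj_on_unique[OF csubspace_UNIV, of z T y] by simp
qed

lemma cinner_adj_left:
  assumes "isometry_op T"
  shows "cinner (adj T x) y = cinner x (T y)"
  using cinner_adj[OF assms, of y x] cinner_commute by metis

lemma adj_add:
  assumes "isometry_op T"
  shows "adj T (x + y) = adj T x + adj T y"
  by (rule cinner_left_cancel) (simp add: cinner_add_right flip: cinner_adj[OF assms])

lemma adj_diff:
  assumes "isometry_op T"
  shows "adj T (x - y) = adj T x - adj T y"
  by (rule cinner_left_cancel) (simp add: cinner_diff_right flip: cinner_adj[OF assms])

lemma adj_scaleC:
  assumes "isometry_op T"
  shows "adj T (scaleC c x) = scaleC c (adj T x)"
  by (rule cinner_left_cancel) (simp add: cinner_scaleC_right flip: cinner_adj[OF assms])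

lemma adj_zero: "isometry_op T \<Longrightarrow> adj T 0 = 0"
  using adj_diff[of T 0 0] by simp

lemma adj_isometry:
  assumes "isometry_op T"
  shows "adj T (T x) = x"
  by (rule cinner_left_cancel) (simp add: isometry_cinner[OF assms] flip: cinner_adj[OF assms])

lemma adj_comp:
  assumes "isometry_op S" "isometry_op T"
  shows "adj (S \<circ> T) x = adj T (adj S x)"
  by (rule cinner_left_cancel)
    (simp flip: cinner_adj[OF isometry_comp[OF assms]] cinner_adj[OF assms(1)] cinner_adj[OF assms(2)])

lemma adj_id: "adj id x = x"
  using adj_isometry[OF isometry_id, of x] by simp

text \<open>Pythagoras for \<open>x = T (adj T x) + (x - T (adj T x))\<close>.\<close>

lemma norm_adj_le:
  assumes "isometry_op T"
  shows "norm (adj T x) \<le> norm x"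
proof -
  have "cinner (T (adj T x)) (x - T (adj T x)) = 0"
    by (simp add: cinner_adj[OF assms] adj_diff[OF assms] adj_isometry[OF assms])
  then have "(norm x)\<^sup>2 = (norm (adj T x))\<^sup>2 + (norm (x - T (adj T x)))\<^sup>2"
    using norm_add_square[of "T (adj T x)" "x - T (adj T x)"] by (simp add: isometry_norm[OF assms])
  then have "(norm (adj T x))\<^sup>2 \<le> (norm x)\<^sup>2"
    using zero_le_power2[of "norm (x - T (adj T x))"] by linarith
  then show ?thesis
    by (rule power2_le_imp_le) simp
qed

section \<open>Kernels of adjoints and range projections\<close>

lemma csubspace_ker_adj: "isometry_op T \<Longrightarrow> csubspace (op_ker (adj T))"
  unfolding csubspace_def op_ker_def by (simp add: adj_zero adj_add adj_scaleC)

text \<open>Since \<open>adj S\<close> is a left inverse of \<open>S\<close>, replacing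
  \<open>w\<close> by \<open>S (adj S w)\<close> does not change the value of
  \<open>adj (S \<circ> R)\<close>.\<close>

lemma range_proj_in_ker_adj:
  assumes "isometry_op S" "isometry_op R" "w \<in> op_ker (adj (S \<circ> R))"
  shows "S (adj S w) \<in> op_ker (adj (S \<circ> R))"
  using assms(3) unfolding op_ker_def by (simp add: adj_comp assms(1,2) adj_isometry)

text \<open>The kernel of \<open>adj T\<close> is the orthogonal complement of the range of
  \<open>T\<close>, whose projection sends \<open>x\<close> to \<open>T (adj T x)\<close>.\<close>

lemma orth_proj_ker_adj:
  assumes "isometry_op T"
  shows "orth_proj (op_ker (adj T)) x = x - T (adj T x)"
  by (rule orth_proj_unique[OF csubspace_ker_adj[OF assms]])
    (auto simp: assms op_ker_def adj_diff adj_isometry cinner_diff_left cinner_adj[OF assms])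

lemma orth_proj_perp_ker_adj:
  "isometry_op T \<Longrightarrow> orth_proj_perp (op_ker (adj T)) x = T (adj T x)"
  by (simp add: orth_proj_perp_def orth_proj_ker_adj)

lemma range_proj_contraction:
  assumes "isometry_op T"
  shows "op_le_on M (\<lambda>x. T (adj T x)) id"
proof -
  have "cinner (x - T (adj T x)) x = complex_of_real ((norm x)\<^sup>2 - (norm (adj T x))\<^sup>2)" for x
    by (simp add: cinner_diff_left cinner_adj[OF assms] cinner_self)
  then show ?thesis
    using norm_adj_le[OF assms]
    by (simp add: op_le_on_def nonneg_Reals_of_real_iff power_mono del: of_real_diff of_real_power)
qed

section \<open>Sums over the wandering subspace\<close>

text \<open>The pairs \<open>(\<Sum>k<m. T\<^sup>k w\<^sub>k, \<Sum>k<m. w\<^sub>k)\<close> with all \<open>w\<^sub>k\<close> in the wandering subspace \<open>ker T\<^sup>*\<close>.\<close>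

inductive wandering_sum :: "('a::complex_hilbert \<Rightarrow> 'a) \<Rightarrow> 'a \<Rightarrow> 'a \<Rightarrow> bool" for T where
  zero: "wandering_sum T 0 0"
| step: "wandering_sum T (w + T x) (w + s)" if "w \<in> op_ker (adj T)" "wandering_sum T x s"

lemma wandering_sum_ker:
  assumes "isometry_op T" "w \<in> op_ker (adj T)"
  shows "wandering_sum T w w"
  using wandering_sum.step[OF assms(2) wandering_sum.zero] by (simp add: isometry_zero[OF assms(1)])

lemma wandering_sum_self:
  assumes "isometry_op T" "w \<in> op_ker (adj T)"
  shows "wandering_sum T (T w) w"
  using wandering_sum.step[of 0 T w w] wandering_sum_ker[OF assms]
  by (simp add: op_ker_def adj_zero assms)

lemma wandering_sum_add:
  assumes "isometry_op T" "w \<in> op_ker (adj T)" "wandering_sum T x s"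
  shows "wandering_sum T (w + x) (w + s)"
  using assms(3)
proof cases
  case zero
  then show ?thesis
    using wandering_sum_ker assms by simp
next
  case (step v y t)
  have "w + v \<in> op_ker (adj T)"
    using step assms by (simp add: op_ker_def adj_add)
  then show ?thesis
    using wandering_sum.step[of "w + v" T y t] step by (simp add: add.assoc)
qed

text \<open>Applying \<open>adj T\<close> to \<open>w + T x\<close> recovers \<open>x\<close> and
  hence \<open>w\<close>, so coefficients can be compared one at a time.\<close>

lemma wandering_sum_unique:
  assumes T: "isometry_op T" and "wandering_sum T x s" "wandering_sum T x t"
  shows "s = t"
proof -
  have cancel: "w = w' \<and> y = y'"
    if "w + T y = w' + T y'" "w \<in> op_ker (adj T)" "w' \<in> op_ker (adj T)" for w w' y y'
  proof -
    have "adj T (w + T y) = adj T (w' + T y')"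
      by (simp only: that)
    then have "y = y'"
      using that(2,3) by (simp add: adj_add adj_isometry T op_ker_def)
    with that show ?thesis
      by simp
  qed
  have zero: "0 = 0 + T 0" "0 \<in> op_ker (adj T)"
    by (simp_all add: isometry_zero[OF T] adj_zero op_ker_def T)
  \<comment> \<open>Representations may differ in length: where one has ended, the remaining
    coefficients of the other represent 0 and must sum to 0.\<close>
  have null: "s = 0" if "wandering_sum T x s" "x = 0" for x s
    using that
  proof (induction rule: wandering_sum.induct)
    case (step w x s)
    then show ?case
      using cancel[of w x 0 0] zero by auto
  qed simp
  show ?thesis
    using assms(2,3)
  proof (induction arbitrary: t rule: wandering_sum.induct)
    case zero
    then show ?case
      using null by blast
  next
    case (step w x s)
    from step.prems show ?case
    proof cases
      case zero
      then show ?thesis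
        using null step.hyps wandering_sum.step by metis
    next
      case (step w' x' s')
      then show ?thesis
        using cancel[of w x w' x'] \<open>w \<in> op_ker (adj T)\<close> \<open>\<And>t. wandering_sum T x t \<Longrightarrow> s = t\<close> by auto
    qed
  qed
qed

section \<open>A commuting pair of isometries and its unitary on the wandering subspace\<close>

locale commuting_isometries =
  fixes A B :: "'a::complex_hilbert \<Rightarrow> 'a"
  assumes A: "isometry_op A" and B: "isometry_op B" and commute: "A \<circ> B = B \<circ> A"
begin

definition W :: "'a set"
  where "W = op_ker (adj (A \<circ> B))"

text \<open>Explicit form of \<open>P_W A + B^*\<close>: since
  \<open>adj (A \<circ> B) (A w) = adj B w\<close>, projecting \<open>A w\<close> onto
  \<open>W\<close> subtracts \<open>A (B (adj B w))\<close>.\<close>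

definition U :: "'a \<Rightarrow> 'a"
  where "U w = A (w - B (adj B w)) + adj B w"

text \<open>This is \<open>U\<close> with \<open>A\<close> and \<open>B\<close> exchanged; on
  \<open>W\<close> it is both the inverse and the adjoint of \<open>U\<close>.\<close>

definition U' :: "'a \<Rightarrow> 'a"
  where "U' w = adj A w + B (w - A (adj A w))"

lemmas isometry_simps =
  isometry_add[OF A] isometry_add[OF B] isometry_diff[OF A] isometry_diff[OF B]
  isometry_zero[OF A] isometry_zero[OF B] isometry_scaleC[OF A] isometry_scaleC[OF B]
  adj_add[OF A] adj_add[OF B] adj_diff[OF A] adj_diff[OF B]
  adj_zero[OF A] adj_zero[OF B] adj_scaleC[OF A] adj_scaleC[OF B]
  adj_isometry[OF A] adj_isometry[OF B]

lemma AB: "isometry_op (A \<circ> B)"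
  using A B by (rule isometry_comp)

lemma commute_apply: "A (B x) = B (A x)"
  using commute by (metis comp_apply)

lemma adj_commute: "adj A (adj B x) = adj B (adj A x)"
  by (metis A B adj_comp commute)

lemma W_iff: "w \<in> W \<longleftrightarrow> adj A (adj B w) = 0"
  by (simp add: W_def op_ker_def adj_comp A B adj_commute)

lemma W_iff': "w \<in> W \<longleftrightarrow> adj B (adj A w) = 0"
  by (simp add: W_iff adj_commute)

lemma csubspace_W: "csubspace W"
  unfolding W_def using AB by (rule csubspace_ker_adj)

lemma ker_adj_subset_W: "op_ker (adj B) \<subseteq> W"
  by (auto simp: W_iff op_ker_def isometry_simps)

lemma U_eq_proj:
  assumes "w \<in> W"
  shows "orth_proj W (A w) + adj B w = U w"
  by (simp add: U_def W_def orth_proj_ker_adj AB adj_comp A B isometry_simps)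

lemma U_in_W: "w \<in> W \<Longrightarrow> U w \<in> W"
  unfolding U_def by (simp add: W_iff' isometry_simps) (simp add: W_iff isometry_simps flip: adj_commute)

lemma U'_in_W: "w \<in> W \<Longrightarrow> U' w \<in> W"
  unfolding U'_def by (simp add: W_iff isometry_simps) (simp add: W_iff' isometry_simps adj_commute)

text \<open>For \<open>w\<close> in \<open>W\<close>, \<open>adj A (U w) = w - B (adj B w)\<close>
  and \<open>U w - A (adj A (U w)) = adj B w\<close>, from which \<open>U'\<close> reassembles
  \<open>w\<close>.\<close>

lemma U'_U: "w \<in> W \<Longrightarrow> U' (U w) = w"
  by (simp add: U_def U'_def isometry_simps W_iff)

lemma U_U': "w \<in> W \<Longrightarrow> U (U' w) = w"
  by (simp add: U_def U'_def isometry_simps W_iff' commute_apply)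

lemma U_add: "U (x + y) = U x + U y"
  by (simp add: U_def isometry_simps)

lemma U'_diff: "U' (x - y) = U' x - U' y"
  by (simp add: U'_def isometry_simps)

lemma U_scaleC: "U (scaleC c x) = scaleC c (U x)"
  by (simp add: U_def isometry_simps scaleC_add_right scaleC_diff_right)

text \<open>The correction terms \<open>A (B (adj B x))\<close> and \<open>B (A (adj A y))\<close>
  pair to zero with \<open>y\<close> and \<open>x\<close> by membership in \<open>W\<close>; the
  other terms match by moving \<open>A\<close> and \<open>B\<close> across.\<close>

lemma cinner_U:
  assumes "x \<in> W" "y \<in> W"
  shows "cinner (U x) y = cinner x (U' y)"
  using assms assms[unfolded W_iff']
  by (simp add: U_def U'_def cinner_add_left cinner_add_right cinner_diff_left cinner_diff_right
      isometry_simps cinner_adj[OF A] cinner_adj[OF B] cinner_adj_left[OF A, symmetric]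
      cinner_adj_left[OF B, symmetric] W_iff W_iff')

text \<open>Only values on \<open>W\<close> matter; the free \<open>F\<close> lets the given
  \<open>U_op\<close> stand in for \<open>U\<close>.\<close>

lemma adj_on_U:
  assumes "y \<in> W" "\<And>w. w \<in> W \<Longrightarrow> F w = U w"
  shows "adj_on W F y = U' y"
  by (rule adj_on_unique) (simp_all add: assms csubspace_W U'_in_W cinner_U)

lemma norm_U:
  assumes "w \<in> W"
  shows "norm (U w) = norm w"
proof -
  have "cinner (U w) (U w) = cinner w w"
    by (simp add: cinner_U assms U_in_W U'_U)
  then have "(norm (U w))\<^sup>2 = (norm w)\<^sup>2"
    by (simp add: norm_eq_cinner)
  then show ?thesis
    by simp
qed

lemma unitary_on_U:
  assumes F: "\<And>w. w \<in> W \<Longrightarrow> F w = U w"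
  shows "unitary_on W F"
proof -
  have "x + y \<in> W" "scaleC c x \<in> W" if "x \<in> W" "y \<in> W" for x y c
    using csubspace_W that unfolding csubspace_def by blast+
  then have "bounded_op_on W F"
    unfolding bounded_op_on_def
    by (auto simp: F U_in_W U_add U_scaleC norm_U intro!: exI[of _ 1])
  then show ?thesis
    by (simp add: unitary_on_def adj_on_U[OF _ F] F U_in_W U'_in_W U_U' U'_U)
qed

text \<open>For \<open>w \<in> W\<close> one has \<open>A w = A (w - B B\<^sup>* w) + A B (B\<^sup>* w)\<close> with \<open>A (w - B B\<^sup>* w)\<close> and \<open>B\<^sup>* w\<close> in \<open>W\<close>;
  dropping the factor \<open>A B\<close> turns this into \<open>U w\<close>.\<close>

lemma wandering_sum_U:
  assumes "wandering_sum (A \<circ> B) x s"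
  shows "wandering_sum (A \<circ> B) (A x) (U s)"
  using assms
proof (induction rule: wandering_sum.induct)
  case zero
  show ?case
    using wandering_sum.zero by (simp add: U_def isometry_simps comp_def)
next
  case (step w x s)
  have w: "w \<in> W"
    using step by (simp add: W_def)
  have "adj B w \<in> op_ker (adj (A \<circ> B))"
    using w by (simp add: W_iff isometry_simps adj_commute flip: W_def)
  then have "wandering_sum (A \<circ> B) (adj B w + A x) (adj B w + U s)"
    using AB step.IH wandering_sum_add by blast
  moreover have "A (w - B (adj B w)) \<in> op_ker (adj (A \<circ> B))"
    using w by (simp add: W_iff' isometry_simps flip: W_def)
  ultimately have "wandering_sum (A \<circ> B) (A (w - B (adj B w)) + (A \<circ> B) (adj B w + A x))
    (A (w - B (adj B w)) + (adj B w + U s))"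
    by (rule wandering_sum.step[rotated])
  moreover have "A (w - B (adj B w)) + (A \<circ> B) (adj B w + A x) = A (w + (A \<circ> B) x)"
    by (simp add: isometry_simps commute_apply)
  moreover have "A (w - B (adj B w)) + (adj B w + U s) = U (w + s)"
    by (simp add: U_add) (simp add: U_def)
  ultimately show ?case
    by (simp add: comp_def)
qed

text \<open>On \<open>W\<close>, \<open>adj A (U w) = w - B (adj B w)\<close>, and
  \<open>adj Q\<close> turns \<open>B\<close> into \<open>R\<close>. Applying \<open>Q\<close> gives
  the difference, and \<open>U'\<close> undoes the remaining \<open>A\<close>.\<close>

lemma conjugate_range_proj:
  assumes "isometry_op Q" "isometry_op R" "B = Q \<circ> R" "w \<in> W"
  shows "U' ((A \<circ> Q) (adj (A \<circ> Q) (U w))) = Q (adj Q w) - B (adj B w)"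
proof -
  have B_apply: "Q (R x) = B x" for x
    by (simp add: assms(3))
  have "adj A (U w) = w - B (adj B w)"
    using assms(4) by (simp add: U_def isometry_simps W_iff)
  then have "adj (A \<circ> Q) (U w) = adj Q w - R (adj B w)"
    using adj_isometry[OF assms(1), of "R (adj B w)"]
    by (simp add: adj_comp[OF A assms(1)] adj_diff[OF assms(1)] B_apply)
  then have "Q (adj (A \<circ> Q) (U w)) = Q (adj Q w) - B (adj B w)"
    by (simp add: isometry_diff[OF assms(1)] B_apply)
  moreover have "U' (A x) = x" for x
    by (simp add: U'_def isometry_simps)
  ultimately show ?thesis
    by simp
qed

end

section \<open>Products along index lists\<close>

lemma op_prod_Nil [simp]: "op_prod T [] = id"
  and op_prod_Cons [simp]: "op_prod T (i # is) = T i \<circ> op_prod T is"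
  by (simp_all add: op_prod_def)

lemma op_prod_append: "op_prod T (is @ js) = op_prod T is \<circ> op_prod T js"
  by (induction "is") (simp_all add: comp_assoc)

text \<open>Left compositions with commuting maps commute, so folding them depends only on the
  multiset; \<open>foldr\<close> becomes \<open>fold\<close> over the reversed list.\<close>

lemma op_prod_mset_cong:
  fixes T :: "nat \<Rightarrow> 'a \<Rightarrow> 'a"
  assumes "mset is = mset js"
    and "\<And>i j. i \<in> set is \<Longrightarrow> j \<in> set is \<Longrightarrow> T i \<circ> T j = T j \<circ> T i"
  shows "op_prod T is = op_prod T js"
proof -
  have "fold (\<lambda>i (S :: 'a \<Rightarrow> 'a). T i \<circ> S) (rev is) = fold (\<lambda>i S. T i \<circ> S) (rev js)"
  proof (rule fold_multiset_equiv)
    fix i j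
    assume "i \<in> set (rev is)" "j \<in> set (rev is)"
    then have "T i \<circ> T j = T j \<circ> T i"
      using assms(2) by simp
    then show "((\<circ>) (T i) :: ('a \<Rightarrow> 'a) \<Rightarrow> _) \<circ> (\<circ>) (T j) = (\<circ>) (T j) \<circ> (\<circ>) (T i)"
      by (simp add: fun_eq_iff)
  qed (simp add: assms)
  then show ?thesis
    by (simp add: op_prod_def foldr_conv_fold)
qed

lemma isometry_op_prod: "(\<And>i. i \<in> set is \<Longrightarrow> isometry_op (T i)) \<Longrightarrow> isometry_op (op_prod T is)"
  by (induction "is") (auto intro: isometry_comp isometry_id)

lemma op_prod_closed:
  assumes "\<And>i w. i \<in> set is \<Longrightarrow> w \<in> M \<Longrightarrow> T i w \<in> M" "w \<in> M"
  shows "op_prod T is w \<in> M"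
  using assms by (induction "is") auto

text \<open>Confined to \<open>M\<close> because it is applied to the \<open>Ustar i\<close>, whose
  additivity is established on \<open>W\<close>.\<close>

lemma op_prod_diff:
  assumes "\<And>i w. i \<in> set is \<Longrightarrow> w \<in> M \<Longrightarrow> T i w \<in> M"
    and "\<And>i v w. i \<in> set is \<Longrightarrow> v \<in> M \<Longrightarrow> w \<in> M \<Longrightarrow> T i (v - w) = T i v - T i w"
    and "v \<in> M" "w \<in> M"
  shows "op_prod T is (v - w) = op_prod T is v - op_prod T is w"
  using assms
proof (induction "is")
  case (Cons i "is")
  then have "op_prod T is v \<in> M" "op_prod T is w \<in> M"
    by (auto intro: op_prod_closed)
  with Cons show ?case
    by simp
qed simp

lemma op_prod_set_cong:
  assumes "distinct is" "distinct js" "set is = set js"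
    and "\<And>i j. i \<in> set is \<Longrightarrow> j \<in> set is \<Longrightarrow> T i \<circ> T j = T j \<circ> T i"
  shows "op_prod T is = op_prod T js"
  using assms by (intro op_prod_mset_cong) (simp_all add: set_eq_iff_mset_eq_distinct)

theorem theorem3p2:
  fixes V :: "nat \<Rightarrow> 'a::complex_hilbert \<Rightarrow> 'a" and n :: nat
  assumes "n \<ge> 2" and "n_isometry n V"
  defines "W \<equiv> W_space n V"
    and "U \<equiv> U_op n V"
    and "Ustar \<equiv> (\<lambda>i. adj_on (W_space n V) (U_op n V i))"
    and "Pperp \<equiv> (\<lambda>i. orth_proj_perp (W_tilde n V i))"
  shows "(\<forall>i\<in>{1..n}. W_tilde n V i \<subseteq> W \<and> unitary_on W (U i)) \<and>
    (\<forall>p\<in>{1..n}. \<forall>q\<in>{1..n}. \<forall>w\<in>W. U p (U q w) = U q (U p w)) \<and>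
    (\<forall>w\<in>W. op_prod U [1..<Suc n] w = w) \<and>
    (\<forall>i j. 1 \<le> i \<and> i < j \<and> j \<le> n \<longrightarrow>
      (\<forall>w\<in>W. Pperp i w + Ustar i (Pperp j (U i w)) = Pperp j w + Ustar j (Pperp i (U j w))) \<and>
      op_le_on W (\<lambda>w. Pperp j w + Ustar j (Pperp i (U j w))) id) \<and>
    (\<forall>w\<in>W. (\<Sum>p=1..n. op_prod Ustar [1..<p] (Pperp p (op_prod U (rev [1..<p]) w))) = w)"
proof -

  \<comment> \<open>Reduction to the commuting pairs \<open>V i\<close>, \<open>T i\<close>\<close>
  have iso: "isometry_op (V i)" if "i \<in> {1..n}" for i
    using assms(2) that by (simp add: n_isometry_def)
  have comm: "V i \<circ> V j = V j \<circ> V i" if "i \<in> {1..n}" "j \<in> {1..n}" for i j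
    using assms(2) that by (simp add: n_isometry_def)
  have cong: "op_prod V is = op_prod V js"
    if "distinct is" "distinct js" "set is = set js" "set js \<subseteq> {1..n}" for "is" js
    using that by (intro op_prod_set_cong comm) auto
  have iso_prod: "isometry_op (op_prod V is)" if "set is \<subseteq> {1..n}" for "is"
    using that iso by (intro isometry_op_prod) auto
  define T where "T = V_tilde n V"
  have iso_T: "isometry_op (T i)" for i
    unfolding T_def V_tilde_def by (rule iso_prod) auto
  have VT: "V i \<circ> T i = V_prod n V" "T i \<circ> V i = V_prod n V" if "i \<in> {1..n}" for i
  proof -
    have "op_prod V (i # filter (\<lambda>j. j \<noteq> i) [1..<Suc n]) = V_prod n V"
      unfolding V_prod_def using that by (intro cong) auto
    then show "V i \<circ> T i = V_prod n V"
      by (simp add: T_def V_tilde_def)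
    have "op_prod V (filter (\<lambda>j. j \<noteq> i) [1..<Suc n] @ [i]) = V_prod n V"
      unfolding V_prod_def using that by (intro cong) auto
    then show "T i \<circ> V i = V_prod n V"
      by (simp add: T_def V_tilde_def op_prod_append)
  qed
  have pair: "commuting_isometries (V i) (T i)" if "i \<in> {1..n}" for i
    using that by unfold_locales (simp_all add: iso iso_T VT)
  have W_ker: "W = op_ker (adj (V_prod n V))"
    by (simp add: W_def W_space_def)
  have W_eq: "W = commuting_isometries.W (V i) (T i)" if "i \<in> {1..n}" for i
    using that by (simp add: W_ker commuting_isometries.W_def[OF pair] VT)
  have U_eq: "U i w = commuting_isometries.U (V i) (T i) w" if "i \<in> {1..n}" "w \<in> W" for i w
    using commuting_isometries.U_eq_proj[OF pair, of i w] that
    by (simp add: U_def U_op_def T_def W_def flip: W_eq[unfolded T_def W_def])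
  have U_in_W: "U i w \<in> W" if "i \<in> {1..n}" "w \<in> W" for i w
    using commuting_isometries.U_in_W[OF pair, of i w] that by (simp add: U_eq flip: W_eq)
  have Ustar_eq: "Ustar i w = commuting_isometries.U' (V i) (T i) w"
    if "i \<in> {1..n}" "w \<in> W" for i w
    using commuting_isometries.adj_on_U[OF pair, of i w "U i"] that
    by (simp add: U_eq Ustar_def flip: W_eq U_def W_def)
  have Ustar_in_W: "Ustar i w \<in> W" if "i \<in> {1..n}" "w \<in> W" for i w
    using commuting_isometries.U'_in_W[OF pair, of i w] that by (simp add: Ustar_eq flip: W_eq)
  have iso_VP: "isometry_op (V_prod n V)"
    unfolding V_prod_def by (rule iso_prod) auto
  have W_sub: "csubspace W"
    using csubspace_ker_adj[OF iso_VP] by (simp add: W_ker)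
  have Ustar_diff: "Ustar i (v - w) = Ustar i v - Ustar i w"
    if "i \<in> {1..n}" "v \<in> W" "w \<in> W" for i v w
    using commuting_isometries.U'_diff[OF pair, of i v w] csubspace_diff[OF W_sub, of v w] that
    by (simp add: Ustar_eq)
  have Pperp_eq: "Pperp i w = T i (adj (T i) w)" for i w
    by (simp add: Pperp_def W_tilde_def orth_proj_perp_ker_adj iso_T flip: T_def)
  have proj_in_W: "Q (adj Q w) \<in> W"
    if "isometry_op Q" "isometry_op R" "V_prod n V = Q \<circ> R" "w \<in> W" for Q R w
    using range_proj_in_ker_adj[OF that(1,2)] that(3,4) by (simp add: W_ker)
  have conjugate: "Ustar i ((V i \<circ> Q) (adj (V i \<circ> Q) (U i w))) = Q (adj Q w) - Pperp i w"
    if "i \<in> {1..n}" "isometry_op Q" "isometry_op R" "T i = Q \<circ> R" "w \<in> W" for i Q R w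
  proof -
    have "V_prod n V = (V i \<circ> Q) \<circ> R"
      using VT(1)[OF that(1)] that(4) by (simp add: comp_assoc)
    \<comment> \<open>\<open>Ustar i\<close> is known to agree with \<open>U'\<close> on
      \<open>W\<close>, so its argument must first be placed in \<open>W\<close>.\<close>
    then have "(V i \<circ> Q) (adj (V i \<circ> Q) (U i w)) \<in> W"
      by (rule proj_in_W[OF isometry_comp[OF iso[OF that(1)] that(2)] that(3) _ U_in_W[OF that(1,5)]])
    then show ?thesis
      using commuting_isometries.conjugate_range_proj[OF pair[OF that(1)] that(2-4)]
        that(5) W_eq[OF that(1)]
      by (simp only: Ustar_eq[OF that(1)] U_eq[OF that(1,5)] Pperp_eq)
  qed

  have unitary: "W_tilde n V i \<subseteq> W \<and> unitary_on W (U i)" if "i \<in> {1..n}" for i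
    using commuting_isometries.ker_adj_subset_W[OF pair, of i]
      commuting_isometries.unitary_on_U[OF pair, of i "U i"] that
    by (simp add: W_tilde_def U_eq flip: W_eq T_def)

  \<comment> \<open>Commutation and product of the \<open>U i\<close>: (a) and (b)\<close>
  have U_prod_in_W: "op_prod U is w \<in> W" if "set is \<subseteq> {1..n}" "w \<in> W" for "is" w
    using that U_in_W by (intro op_prod_closed) auto
  \<comment> \<open>Each \<open>V i\<close> on the vector is matched by \<open>U i\<close> on the
    sum, so by uniqueness equal products of the \<open>V i\<close> force equal products of the
    \<open>U i\<close> on \<open>W\<close>.\<close>
  have sum_prod: "wandering_sum (V_prod n V) (op_prod V is w) (op_prod U is w)"
    if "set is \<subseteq> {1..n}" "w \<in> W" for "is" w
    using that(1)
  proof (induction "is")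
    case Nil
    show ?case
      using wandering_sum_ker[OF iso_VP, of w] that(2) by (simp add: W_ker)
  next
    case (Cons i "is")
    then show ?case
      using commuting_isometries.wandering_sum_U[OF pair, of i "op_prod V is w" "op_prod U is w"]
        U_prod_in_W[OF _ that(2), of "is"]
      by (simp add: VT U_eq)
  qed
  have U_commute: "U p (U q w) = U q (U p w)"
    if "p \<in> {1..n}" "q \<in> {1..n}" "w \<in> W" for p q w
  proof -
    have "op_prod V [p, q] = op_prod V [q, p]"
      using comm[OF that(1,2)] by simp
    then have "op_prod U [p, q] w = op_prod U [q, p] w"
      using sum_prod[of "[p, q]" w] sum_prod[of "[q, p]" w] that
      by (intro wandering_sum_unique[OF iso_VP]) auto
    then show ?thesis
      by simp
  qed
  have U_prod: "op_prod U [1..<Suc n] w = w" if "w \<in> W" for w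
  proof (rule wandering_sum_unique[OF iso_VP])
    show "wandering_sum (V_prod n V) (V_prod n V w) (op_prod U [1..<Suc n] w)"
      \<comment> \<open>Instantiated at \<open>w\<close>, so that the parameter
        \<open>V_prod n V\<close> of \<open>wandering_sum\<close> stays folded.\<close>
      unfolding V_prod_def[of n V, THEN fun_cong, of w] using that by (intro sum_prod) auto
    show "wandering_sum (V_prod n V) (V_prod n V w) w"
      using that by (intro wandering_sum_self iso_VP) (simp add: W_ker)
  qed

  \<comment> \<open>The pairwise identity and inequality (c)\<close>
  have pair_proj: "\<exists>S. isometry_op S \<and>
      (\<forall>w\<in>W. Pperp i w + Ustar i (Pperp j (U i w)) = S (adj S w)) \<and>
      (\<forall>w\<in>W. Pperp j w + Ustar j (Pperp i (U j w)) = S (adj S w))"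
    if "i \<in> {1..n}" "j \<in> {1..n}" "i \<noteq> j" for i j
  proof -
    let ?ks = "filter (\<lambda>k. k \<noteq> i \<and> k \<noteq> j) [1..<Suc n]"
    define S where "S = op_prod V ?ks"
    have S: "isometry_op S"
      unfolding S_def by (rule iso_prod) auto
    \<comment> \<open>Both orders are needed: \<open>T i = S \<circ> V j\<close> fits
      \<open>conjugate\<close> with \<open>Q = S\<close>, and \<open>T j = V i \<circ> S\<close>
      makes \<open>Pperp j\<close> the projection being conjugated.\<close>
    have T_simps: "op_prod V (?ks @ [j]) = T i" "op_prod V (j # ?ks) = T i"
      "op_prod V (?ks @ [i]) = T j" "op_prod V (i # ?ks) = T j"
      unfolding T_def V_tilde_def by (rule cong; use that in auto)+
    then have T: "T i = S \<circ> V j" "T i = V j \<circ> S" "T j = S \<circ> V i" "T j = V i \<circ> S"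
      by (simp_all add: S_def op_prod_append)
    have "Ustar i (Pperp j (U i w)) = S (adj S w) - Pperp i w" if "w \<in> W" for w
      using conjugate[OF \<open>i \<in> {1..n}\<close> S iso[OF \<open>j \<in> {1..n}\<close>] T(1) that]
      by (simp only: Pperp_eq[of j] T(4))
    moreover have "Ustar j (Pperp i (U j w)) = S (adj S w) - Pperp j w" if "w \<in> W" for w
      using conjugate[OF \<open>j \<in> {1..n}\<close> S iso[OF \<open>i \<in> {1..n}\<close>] T(3) that]
      by (simp only: Pperp_eq[of i] T(2))
    ultimately show ?thesis
      using S by (intro exI[of _ S]) simp
  qed
  have pair_sum: "(\<forall>w\<in>W. Pperp i w + Ustar i (Pperp j (U i w)) = Pperp j w + Ustar j (Pperp i (U j w))) \<and>
      op_le_on W (\<lambda>w. Pperp j w + Ustar j (Pperp i (U j w))) id"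
    if "1 \<le> i \<and> i < j \<and> j \<le> n" for i j
  proof -
    obtain S where S: "isometry_op S"
      "\<forall>w\<in>W. Pperp i w + Ustar i (Pperp j (U i w)) = S (adj S w)"
      "\<forall>w\<in>W. Pperp j w + Ustar j (Pperp i (U j w)) = S (adj S w)"
      using pair_proj[of i j] \<open>1 \<le> i \<and> i < j \<and> j \<le> n\<close> by auto
    then show ?thesis
      using range_proj_contraction[OF S(1), of W] by (simp add: op_le_on_def)
  qed

  \<comment> \<open>The telescoping sum (d)\<close>
  have telescope: "(\<Sum>p=1..n. op_prod Ustar [1..<p] (Pperp p (op_prod U (rev [1..<p]) w))) = w"
    if w: "w \<in> W" for w
  proof -
    define R where "R k = op_prod V [1..<k]" for k
    \<comment> \<open>The range projection of \<open>R k\<close>, conjugated by the first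
      \<open>k - 1\<close> unitaries. As \<open>R 1\<close> is the identity and
      \<open>R (Suc n)\<close> is \<open>V_prod n V\<close>, the values run from \<open>w\<close> to
      0.\<close>
    define g where "g k = op_prod Ustar [1..<k] (R k (adj (R k) (op_prod U (rev [1..<k]) w)))" for k
    have step: "op_prod Ustar [1..<k] (Pperp k (op_prod U (rev [1..<k]) w)) = g k - g (Suc k)"
      if k: "k \<in> {1..n}" for k
    proof -
      define x where "x = op_prod U (rev [1..<k]) w"
      have x: "x \<in> W"
        unfolding x_def using k w by (intro U_prod_in_W) auto
      define R' where "R' = op_prod V [Suc k..<Suc n]"
      have R: "isometry_op (R k)" "isometry_op R'"
        unfolding R_def R'_def by (rule iso_prod; use k in auto)+
      have "op_prod V ([1..<k] @ [Suc k..<Suc n]) = T k"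
        unfolding T_def V_tilde_def using k by (intro cong) auto
      then have T_k: "T k = R k \<circ> R'"
        by (simp add: R_def R'_def op_prod_append)
      have "op_prod V (k # [1..<k]) = op_prod V [1..<Suc k]"
        using k by (intro cong) auto
      then have R_Suc: "V k \<circ> R k = R (Suc k)"
        by (simp add: R_def)
      \<comment> \<open>In \<open>g (Suc k)\<close> the new factors \<open>Ustar k\<close> and
        \<open>U k\<close> sit next to the range projection, so \<open>conjugate\<close> applies
        with \<open>Q = R k\<close>.\<close>
      have upt: "[1..<Suc k] = [1..<k] @ [k]"
        using k by simp
      have "R k (adj (R k) x) \<in> W"
      proof (rule proj_in_W)
        show "isometry_op (R' \<circ> V k)"
          using R k by (intro isometry_comp iso)
        show "V_prod n V = R k \<circ> (R' \<circ> V k)"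
          using VT(2)[OF k] by (simp add: T_k comp_assoc)
      qed (use R x in auto)
      moreover have "Pperp k x \<in> W"
        unfolding Pperp_eq using k x VT(2)[OF k] by (intro proj_in_W[OF iso_T iso[OF k]]) auto
      ultimately have "op_prod Ustar [1..<k] (R k (adj (R k) x) - Pperp k x)
          = op_prod Ustar [1..<k] (R k (adj (R k) x)) - op_prod Ustar [1..<k] (Pperp k x)"
        using k by (intro op_prod_diff[where M = W]) (auto intro: Ustar_in_W Ustar_diff)
      moreover have "Ustar k (R (Suc k) (adj (R (Suc k)) (U k x))) = R k (adj (R k) x) - Pperp k x"
        using conjugate[OF k R T_k x] by (simp only: R_Suc)
      then have "g (Suc k) = op_prod Ustar [1..<k] (R k (adj (R k) x) - Pperp k x)"
        by (simp only: g_def upt op_prod_append rev_append) (simp add: x_def)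
      moreover have "g k = op_prod Ustar [1..<k] (R k (adj (R k) x))"
        by (simp add: g_def x_def)
      ultimately show ?thesis
        by (simp add: x_def)
    qed
    have "op_prod U (rev [1..<Suc n]) w \<in> W"
      using w by (intro U_prod_in_W) auto
    then have "R (Suc n) (adj (R (Suc n)) (op_prod U (rev [1..<Suc n]) w)) = 0"
      unfolding R_def V_prod_def[symmetric] W_ker op_ker_def
      by (simp only: mem_Collect_eq isometry_zero[OF iso_VP])
    \<comment> \<open>Writing 0 as \<open>0 - 0\<close> derives vanishing at 0 from compatibility
      with differences.\<close>
    moreover have "op_prod Ustar [1..<Suc n] (0 - 0) = 0"
      using W_sub
      by (subst op_prod_diff[where M = W])
        (auto intro: Ustar_in_W Ustar_diff simp: csubspace_def)
    ultimately have "g (Suc n) = 0"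
      by (simp only: g_def) simp
    moreover have "g 1 = w"
      by (simp add: g_def R_def adj_id)
    \<comment> \<open>The rule sums \<open>f (Suc k) - f k\<close>, hence the sign in
      \<open>- g k\<close>.\<close>
    moreover have "(\<Sum>p=1..n. g p - g (Suc p)) = g 1 - g (Suc n)"
      using sum_Suc_diff[of 1 n "\<lambda>k. - g k"] by simp
    ultimately show ?thesis
      using step by simp
  qed

  show ?thesis
    using unitary U_commute U_prod pair_sum telescope by blast
qed

end
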